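(* Let $\mathcal{B}$ be a Gray monoid and let $(A,p,j,\alpha,\lambda,\rho)$ be a skew monoidale in $\mathcal{B}$. Then its units are unique up to a unique isomorphism: for any two objects $(j_1,\lambda_1,\rho_1)$ and $(j_2,\lambda_2,\rho_2)$ of $\mathcal{U}(A,p,\alpha)$ there is a unique isomorphism $(j_1,\lambda_1,\rho_1)\to(j_2,\lambda_2,\rho_2)$ in $\mathcal{U}(A,p,\alpha)$.
   Context: Gray monoid. A Gray monoid $\mathcal{B}$ is a 2-category with an object $I$ and, for all objects $A,B$, 2-functors $A\otimes-$ and $-\otimes B:\mathcal{B}\to\mathcal{B}$ which agree on objects (common value $A\otimes B$), are strictly unital and associative ($I\otimes-$ and $-\otimes I$ are identities; $A\otimes(B\otimes-)=(A\otimes B)\otimes-$; $(-\otimes A)\otimes B=-\otimes(A\otimes B)$; $(A\otimes-)\otimes B=A\otimes(-\otimes B)$), together with, for 1-cells $f:A\to A'$, $g:B\to B'$, an invertible 2-cell $$c_{f,g}:(1_{A'}\otimes g)(f\otimes 1_B)\Rightarrow(f\otimes 1_{B'})(1_A\otimes g),$$ where $f\otimes 1_B$ and $1_A\otimes g$ denote the images under $-\otimes B$ and $A\otimes-$. These 2-cells are natural with respect to 2-cells $f\Rightarrow f_1$, $g\Rightarrow g_1$; are identities if $f$ or $g$ is an identity; satisfy $c_{f'f,g}=((f'\otimes1)c_{f,g})\circ(c_{f',g}(f\otimes1))$ and $c_{f,g'g}=(c_{f,g'}(1\otimes g))\circ((1\otimes g')c_{f,g})$; and satisfy $1_C\otimes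 c_{f,g}=c_{1_C\otimes f,g}$, $c_{f\otimes1_C,g}=c_{f,1_C\otimes g}$, $c_{f,g}\otimes1_C=c_{f,g\otimes1_C}$. Below $1$ denotes identity 1-cells, juxtaposition denotes composition of 1-cells and whiskering, and $\circ$ is vertical composition. Skew semimonoidale. A skew semimonoidale $(A,p,\alpha)$ in $\mathcal{B}$ is an object $A$ with a 1-cell $p:A\otimes A\to A$ and a 2-cell (not assumed invertible) $\alpha:p(p\otimes1)\Rightarrow p(1\otimes p)$ such that, as 2-cells $p(p\otimes1)(p\otimes1\otimes1)\Rightarrow p(1\otimes p)(1\otimes1\otimes p)$, $$(\alpha(1\otimes1\otimes p))\circ(p\,c_{p,p})\circ(\alpha(p\otimes1\otimes1))=(p(1\otimes\alpha))\circ(\alpha(1\otimes p\otimes1))\circ(p(\alpha\otimes1)).$$ Category of units. The objects of $\mathcal{U}(A,p,\alpha)$, called units, are triples $(j,\lambda,\rho)$ with $j:I\to A$ a 1-cell and $\lambda:p(j\otimes1)\Rightarrow1_A$, $\rho:1_A\Rightarrow p(1\otimes j)$ 2-cells (not assumed invertible) such that: - $(\lambda p)\circ(p\,c_{j,p})\circ(\alpha(j\otimes1\otimes1))=p(\lambda\otimes1)$; - $(\alpha(1\otimes1\otimes j))\circ(p\,c_{p,j})\circ(\rho p)=p(1\otimes\rho)$; - $(p(1\otimes\lambda))\circ(\alpha(1\otimes j\otimes1))\circ(p(\rho\otimes1))=1_p$; - $(\lambda j)\circ(p\,c_{j,j})\circ(\rho j)=1_j$. A morphism $(j',\lambda',\rho')\to(j,\lambda,\rho)$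 in $\mathcal{U}(A,p,\alpha)$ is a 2-cell $\varphi:j'\Rightarrow j$ with $\lambda\circ(p(\varphi\otimes1))=\lambda'$ and $(p(1\otimes\varphi))\circ\rho'=\rho$; composition is vertical composition of 2-cells. Skew monoidale. A skew semimonoidale $(A,p,\alpha)$ is a skew monoidale if $\mathcal{U}(A,p,\alpha)$ is non-empty; it is written $(A,p,j,\alpha,\lambda,\rho)$ with $(j,\lambda,\rho)$ an object of $\mathcal{U}(A,p,\alpha)$. *)

theory Defs
  imports Main
begin

section \<open>Categories\<close>

text \<open>
  Hom-sets of different pairs of objects may overlap, so a morphism does not determine its
  source and target; this is convenient for categories of structured objects such as the
  category of units below, where a morphism is a bare 2-cell.
\<close>

record ('x, 'm) cat =
  CObj :: "'x set"
  CHom :: "'x \<Rightarrow> 'x \<Rightarrow> 'm set"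
  CId :: "'x \<Rightarrow> 'm"
  CComp :: "'m \<Rightarrow> 'm \<Rightarrow> 'm"

locale category =
  fixes C :: "('x, 'm, 'z) cat_scheme"
  assumes id_in: "x \<in> CObj C \<Longrightarrow> CId C x \<in> CHom C x x"
    and comp_in: "\<lbrakk>x \<in> CObj C; y \<in> CObj C; z \<in> CObj C; f \<in> CHom C x y; g \<in> CHom C y z\<rbrakk>
      \<Longrightarrow> CComp C g f \<in> CHom C x z"
    and id_left: "\<lbrakk>x \<in> CObj C; y \<in> CObj C; f \<in> CHom C x y\<rbrakk> \<Longrightarrow> CComp C (CId C y) f = f"
    and id_right: "\<lbrakk>x \<in> CObj C; y \<in> CObj C; f \<in> CHom C x y\<rbrakk> \<Longrightarrow> CComp C f (CId C x) = f"
    and assoc: "\<lbrakk>w \<in> CObj C; x \<in> CObj C; y \<in> CObj C; z \<in> CObj C;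
        f \<in> CHom C w x; g \<in> CHom C x y; h \<in> CHom C y z\<rbrakk>
      \<Longrightarrow> CComp C (CComp C h g) f = CComp C h (CComp C g f)"

definition isomorphism :: "('x, 'm, 'z) cat_scheme \<Rightarrow> 'x \<Rightarrow> 'x \<Rightarrow> 'm \<Rightarrow> bool" where
  "isomorphism C x y f \<longleftrightarrow> x \<in> CObj C \<and> y \<in> CObj C \<and> f \<in> CHom C x y \<and>
     (\<exists>g \<in> CHom C y x. CComp C g f = CId C x \<and> CComp C f g = CId C y)"


section \<open>Strict 2-categories and 2-functors\<close>

text \<open>
  \<open>g \<cdot> f\<close> is composition of 1-cells, \<open>\<beta> \<bullet> \<alpha>\<close> vertical and \<open>\<beta> \<star> \<alpha>\<close> horizontal composition
  of 2-cells, all in the order of function composition.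
\<close>

record ('o, 'a, 'c) two_cat =
  Obj :: "'o set"
  Cell1 :: "'a set"
  Src :: "'a \<Rightarrow> 'o"
  Tgt :: "'a \<Rightarrow> 'o"
  Id1 :: "'o \<Rightarrow> 'a"
  Comp1 :: "'a \<Rightarrow> 'a \<Rightarrow> 'a" (infixr "\<cdot>\<index>" 75)
  Cell2 :: "'c set"
  Dom :: "'c \<Rightarrow> 'a"
  Cod :: "'c \<Rightarrow> 'a"
  Id2 :: "'a \<Rightarrow> 'c"
  Vcomp :: "'c \<Rightarrow> 'c \<Rightarrow> 'c" (infixr "\<bullet>\<index>" 60)
  Hcomp :: "'c \<Rightarrow> 'c \<Rightarrow> 'c" (infixr "\<star>\<index>" 70)

definition hom1 :: "('o, 'a, 'c, 'z) two_cat_scheme \<Rightarrow> 'o \<Rightarrow> 'o \<Rightarrow> 'a set" where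
  "hom1 B X Y = {f \<in> Cell1 B. Src B f = X \<and> Tgt B f = Y}"

definition hom2 :: "('o, 'a, 'c, 'z) two_cat_scheme \<Rightarrow> 'a \<Rightarrow> 'a \<Rightarrow> 'c set" where
  "hom2 B f g = {\<phi> \<in> Cell2 B. Dom B \<phi> = f \<and> Cod B \<phi> = g}"

definition lwhisker :: "('o, 'a, 'c, 'z) two_cat_scheme \<Rightarrow> 'a \<Rightarrow> 'c \<Rightarrow> 'c"
    (infixr "\<rhd>\<index>" 72) where
  "f \<rhd>\<^bsub>B\<^esub> \<phi> = Id2 B f \<star>\<^bsub>B\<^esub> \<phi>"

definition rwhisker :: "('o, 'a, 'c, 'z) two_cat_scheme \<Rightarrow> 'c \<Rightarrow> 'a \<Rightarrow> 'c"
    (infixl "\<lhd>\<index>" 72) where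
  "\<phi> \<lhd>\<^bsub>B\<^esub> f = \<phi> \<star>\<^bsub>B\<^esub> Id2 B f"

locale two_category =
  fixes B :: "('o, 'a, 'c, 'z) two_cat_scheme" (structure)
  assumes src_tgt: "f \<in> Cell1 B \<Longrightarrow> Src B f \<in> Obj B \<and> Tgt B f \<in> Obj B"
    and id1_in: "X \<in> Obj B \<Longrightarrow> Id1 B X \<in> hom1 B X X"
    and comp1_in: "\<lbrakk>f \<in> hom1 B X Y; g \<in> hom1 B Y Z\<rbrakk> \<Longrightarrow> g \<cdot> f \<in> hom1 B X Z"
    and id1_left: "f \<in> hom1 B X Y \<Longrightarrow> Id1 B Y \<cdot> f = f"
    and id1_right: "f \<in> hom1 B X Y \<Longrightarrow> f \<cdot> Id1 B X = f"
    and comp1_assoc: "\<lbrakk>f \<in> hom1 B W X; g \<in> hom1 B X Y; h \<in> hom1 B Y Z\<rbrakk>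
      \<Longrightarrow> (h \<cdot> g) \<cdot> f = h \<cdot> (g \<cdot> f)"
    and dom_cod: "\<phi> \<in> Cell2 B \<Longrightarrow> Dom B \<phi> \<in> Cell1 B \<and> Cod B \<phi> \<in> Cell1 B \<and>
      Src B (Dom B \<phi>) = Src B (Cod B \<phi>) \<and> Tgt B (Dom B \<phi>) = Tgt B (Cod B \<phi>)"
    and id2_in: "f \<in> Cell1 B \<Longrightarrow> Id2 B f \<in> hom2 B f f"
    and vcomp_in: "\<lbrakk>\<phi> \<in> hom2 B f g; \<psi> \<in> hom2 B g h\<rbrakk> \<Longrightarrow> \<psi> \<bullet> \<phi> \<in> hom2 B f h"
    and id2_left: "\<phi> \<in> hom2 B f g \<Longrightarrow> Id2 B g \<bullet> \<phi> = \<phi>"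
    and id2_right: "\<phi> \<in> hom2 B f g \<Longrightarrow> \<phi> \<bullet> Id2 B f = \<phi>"
    and vcomp_assoc: "\<lbrakk>\<phi> \<in> hom2 B f g; \<psi> \<in> hom2 B g h; \<chi> \<in> hom2 B h k\<rbrakk>
      \<Longrightarrow> (\<chi> \<bullet> \<psi>) \<bullet> \<phi> = \<chi> \<bullet> (\<psi> \<bullet> \<phi>)"
    and hcomp_in: "\<lbrakk>f \<in> hom1 B X Y; f' \<in> hom1 B X Y; g \<in> hom1 B Y Z; g' \<in> hom1 B Y Z;
        \<phi> \<in> hom2 B f f'; \<psi> \<in> hom2 B g g'\<rbrakk>
      \<Longrightarrow> \<psi> \<star> \<phi> \<in> hom2 B (g \<cdot> f) (g' \<cdot> f')"
    and hcomp_id2: "\<lbrakk>f \<in> hom1 B X Y; g \<in> hom1 B Y Z\<rbrakk> \<Longrightarrow> Id2 B g \<star> Id2 B f = Id2 B (g \<cdot> f)"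
    and interchange: "\<lbrakk>f \<in> hom1 B X Y; f' \<in> hom1 B X Y; f'' \<in> hom1 B X Y;
        g \<in> hom1 B Y Z; g' \<in> hom1 B Y Z; g'' \<in> hom1 B Y Z;
        \<phi> \<in> hom2 B f f'; \<phi>' \<in> hom2 B f' f''; \<psi> \<in> hom2 B g g'; \<psi>' \<in> hom2 B g' g''\<rbrakk>
      \<Longrightarrow> (\<psi>' \<bullet> \<psi>) \<star> (\<phi>' \<bullet> \<phi>) = (\<psi>' \<star> \<phi>') \<bullet> (\<psi> \<star> \<phi>)"
    and hcomp_id_left: "\<lbrakk>f \<in> hom1 B X Y; f' \<in> hom1 B X Y; \<phi> \<in> hom2 B f f'\<rbrakk>
      \<Longrightarrow> Id2 B (Id1 B Y) \<star> \<phi> = \<phi>"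
    and hcomp_id_right: "\<lbrakk>f \<in> hom1 B X Y; f' \<in> hom1 B X Y; \<phi> \<in> hom2 B f f'\<rbrakk>
      \<Longrightarrow> \<phi> \<star> Id2 B (Id1 B X) = \<phi>"
    and hcomp_assoc: "\<lbrakk>f \<in> hom1 B W X; f' \<in> hom1 B W X; g \<in> hom1 B X Y; g' \<in> hom1 B X Y;
        h \<in> hom1 B Y Z; h' \<in> hom1 B Y Z;
        \<phi> \<in> hom2 B f f'; \<psi> \<in> hom2 B g g'; \<chi> \<in> hom2 B h h'\<rbrakk>
      \<Longrightarrow> (\<chi> \<star> \<psi>) \<star> \<phi> = \<chi> \<star> (\<psi> \<star> \<phi>)"

definition invertible2 :: "('o, 'a, 'c, 'z) two_cat_scheme \<Rightarrow> 'c \<Rightarrow> bool" where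
  "invertible2 B \<phi> \<longleftrightarrow> \<phi> \<in> Cell2 B \<and>
     (\<exists>\<psi> \<in> hom2 B (Cod B \<phi>) (Dom B \<phi>).
        \<psi> \<bullet>\<^bsub>B\<^esub> \<phi> = Id2 B (Dom B \<phi>) \<and> \<phi> \<bullet>\<^bsub>B\<^esub> \<psi> = Id2 B (Cod B \<phi>))"

locale two_functor = C: two_category C + D: two_category D
  for C :: "('o, 'a, 'c, 'z) two_cat_scheme" and D :: "('p, 'b, 'd, 'w) two_cat_scheme" +
  fixes F0 :: "'o \<Rightarrow> 'p" and F1 :: "'a \<Rightarrow> 'b" and F2 :: "'c \<Rightarrow> 'd"
  assumes F0_in: "X \<in> Obj C \<Longrightarrow> F0 X \<in> Obj D"
    and F1_in: "f \<in> hom1 C X Y \<Longrightarrow> F1 f \<in> hom1 D (F0 X) (F0 Y)"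
    and F2_in: "\<phi> \<in> hom2 C f g \<Longrightarrow> F2 \<phi> \<in> hom2 D (F1 f) (F1 g)"
    and F1_id: "X \<in> Obj C \<Longrightarrow> F1 (Id1 C X) = Id1 D (F0 X)"
    and F1_comp: "\<lbrakk>f \<in> hom1 C X Y; g \<in> hom1 C Y Z\<rbrakk> \<Longrightarrow> F1 (g \<cdot>\<^bsub>C\<^esub> f) = F1 g \<cdot>\<^bsub>D\<^esub> F1 f"
    and F2_id: "f \<in> Cell1 C \<Longrightarrow> F2 (Id2 C f) = Id2 D (F1 f)"
    and F2_vcomp: "\<lbrakk>\<phi> \<in> hom2 C f g; \<psi> \<in> hom2 C g h\<rbrakk>
      \<Longrightarrow> F2 (\<psi> \<bullet>\<^bsub>C\<^esub> \<phi>) = F2 \<psi> \<bullet>\<^bsub>D\<^esub> F2 \<phi>"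
    and F2_hcomp: "\<lbrakk>f \<in> hom1 C X Y; f' \<in> hom1 C X Y; g \<in> hom1 C Y Z; g' \<in> hom1 C Y Z;
        \<phi> \<in> hom2 C f f'; \<psi> \<in> hom2 C g g'\<rbrakk>
      \<Longrightarrow> F2 (\<psi> \<star>\<^bsub>C\<^esub> \<phi>) = F2 \<psi> \<star>\<^bsub>D\<^esub> F2 \<phi>"


section \<open>Gray monoids\<close>

text \<open>
  The 2-functor \<open>X \<otimes> -\<close> acts by \<open>X \<otimes> Y\<close> on objects, \<open>X \<ltimes> g\<close> on 1-cells (written
  \<open>1 \<otimes> g\<close> informally) and \<open>X \<ltimes>\<^sub>2 \<psi>\<close> on 2-cells; the 2-functor \<open>- \<otimes> Y\<close> acts by \<open>X \<otimes> Y\<close>,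
  \<open>f \<rtimes> Y\<close> (written \<open>f \<otimes> 1\<close>) and \<open>\<phi> \<rtimes>\<^sub>2 Y\<close>.
  \<open>Inter B f g\<close> is the interchange 2-cell \<open>c\<^bsub>f,g\<^esub>\<close>.
\<close>

record ('o, 'a, 'c) gray = "('o, 'a, 'c) two_cat" +
  Unit :: 'o
  Tensor :: "'o \<Rightarrow> 'o \<Rightarrow> 'o" (infixr "\<otimes>\<index>" 85)
  LTensor1 :: "'o \<Rightarrow> 'a \<Rightarrow> 'a" (infixr "\<ltimes>\<index>" 80)
  LTensor2 :: "'o \<Rightarrow> 'c \<Rightarrow> 'c" (infixr "\<ltimes>\<^sub>2\<index>" 80)
  RTensor1 :: "'a \<Rightarrow> 'o \<Rightarrow> 'a" (infixl "\<rtimes>\<index>" 80)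
  RTensor2 :: "'c \<Rightarrow> 'o \<Rightarrow> 'c" (infixl "\<rtimes>\<^sub>2\<index>" 80)
  Inter :: "'a \<Rightarrow> 'a \<Rightarrow> 'c"

locale gray_monoid = two_category B
  for B :: "('o, 'a, 'c, 'z) gray_scheme" (structure) +
  assumes unit_in: "Unit B \<in> Obj B"
    and left_functor: "X \<in> Obj B \<Longrightarrow>
      two_functor B B (\<lambda>Y. X \<otimes> Y) (\<lambda>g. X \<ltimes> g) (\<lambda>\<psi>. X \<ltimes>\<^sub>2 \<psi>)"
    and right_functor: "Y \<in> Obj B \<Longrightarrow>
      two_functor B B (\<lambda>X. X \<otimes> Y) (\<lambda>f. f \<rtimes> Y) (\<lambda>\<phi>. \<phi> \<rtimes>\<^sub>2 Y)"
    \<comment> \<open>\<open>I \<otimes> -\<close> and \<open>- \<otimes> I\<close> are identities\<close>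
    and unit_left0: "X \<in> Obj B \<Longrightarrow> Unit B \<otimes> X = X"
    and unit_left1: "f \<in> Cell1 B \<Longrightarrow> Unit B \<ltimes> f = f"
    and unit_left2: "\<phi> \<in> Cell2 B \<Longrightarrow> Unit B \<ltimes>\<^sub>2 \<phi> = \<phi>"
    and unit_right0: "X \<in> Obj B \<Longrightarrow> X \<otimes> Unit B = X"
    and unit_right1: "f \<in> Cell1 B \<Longrightarrow> f \<rtimes> Unit B = f"
    and unit_right2: "\<phi> \<in> Cell2 B \<Longrightarrow> \<phi> \<rtimes>\<^sub>2 Unit B = \<phi>"
    \<comment> \<open>On objects the three associativity conditions coincide.\<close>
    and assoc0: "\<lbrakk>X \<in> Obj B; Y \<in> Obj B; Z \<in> Obj B\<rbrakk> \<Longrightarrow> (X \<otimes> Y) \<otimes> Z = X \<otimes> (Y \<otimes> Z)"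
    and assoc_left1: "\<lbrakk>X \<in> Obj B; Y \<in> Obj B; f \<in> Cell1 B\<rbrakk>
      \<Longrightarrow> X \<ltimes> (Y \<ltimes> f) = (X \<otimes> Y) \<ltimes> f"
    and assoc_left2: "\<lbrakk>X \<in> Obj B; Y \<in> Obj B; \<phi> \<in> Cell2 B\<rbrakk>
      \<Longrightarrow> X \<ltimes>\<^sub>2 (Y \<ltimes>\<^sub>2 \<phi>) = (X \<otimes> Y) \<ltimes>\<^sub>2 \<phi>"
    and assoc_right1: "\<lbrakk>X \<in> Obj B; Y \<in> Obj B; f \<in> Cell1 B\<rbrakk>
      \<Longrightarrow> (f \<rtimes> X) \<rtimes> Y = f \<rtimes> (X \<otimes> Y)"
    and assoc_right2: "\<lbrakk>X \<in> Obj B; Y \<in> Obj B; \<phi> \<in> Cell2 B\<rbrakk>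
      \<Longrightarrow> (\<phi> \<rtimes>\<^sub>2 X) \<rtimes>\<^sub>2 Y = \<phi> \<rtimes>\<^sub>2 (X \<otimes> Y)"
    and assoc_mid1: "\<lbrakk>X \<in> Obj B; Y \<in> Obj B; f \<in> Cell1 B\<rbrakk>
      \<Longrightarrow> (X \<ltimes> f) \<rtimes> Y = X \<ltimes> (f \<rtimes> Y)"
    and assoc_mid2: "\<lbrakk>X \<in> Obj B; Y \<in> Obj B; \<phi> \<in> Cell2 B\<rbrakk>
      \<Longrightarrow> (X \<ltimes>\<^sub>2 \<phi>) \<rtimes>\<^sub>2 Y = X \<ltimes>\<^sub>2 (\<phi> \<rtimes>\<^sub>2 Y)"
    and inter_in: "\<lbrakk>f \<in> hom1 B X X'; g \<in> hom1 B Y Y'\<rbrakk>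
      \<Longrightarrow> Inter B f g \<in> hom2 B ((X' \<ltimes> g) \<cdot> (f \<rtimes> Y)) ((f \<rtimes> Y') \<cdot> (X \<ltimes> g))"
    and inter_invertible: "\<lbrakk>f \<in> hom1 B X X'; g \<in> hom1 B Y Y'\<rbrakk> \<Longrightarrow> invertible2 B (Inter B f g)"
    and inter_natural: "\<lbrakk>f \<in> hom1 B X X'; f\<^sub>1 \<in> hom1 B X X'; g \<in> hom1 B Y Y'; g\<^sub>1 \<in> hom1 B Y Y';
        \<phi> \<in> hom2 B f f\<^sub>1; \<psi> \<in> hom2 B g g\<^sub>1\<rbrakk>
      \<Longrightarrow> Inter B f\<^sub>1 g\<^sub>1 \<bullet> ((X' \<ltimes>\<^sub>2 \<psi>) \<star> (\<phi> \<rtimes>\<^sub>2 Y))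
        = ((\<phi> \<rtimes>\<^sub>2 Y') \<star> (X \<ltimes>\<^sub>2 \<psi>)) \<bullet> Inter B f g"
    and inter_id_left: "\<lbrakk>X \<in> Obj B; g \<in> Cell1 B\<rbrakk>
      \<Longrightarrow> Inter B (Id1 B X) g = Id2 B (X \<ltimes> g)"
    and inter_id_right: "\<lbrakk>f \<in> Cell1 B; Y \<in> Obj B\<rbrakk>
      \<Longrightarrow> Inter B f (Id1 B Y) = Id2 B (f \<rtimes> Y)"
    and inter_comp_left: "\<lbrakk>f \<in> hom1 B X X'; f' \<in> hom1 B X' X''; g \<in> hom1 B Y Y'\<rbrakk>
      \<Longrightarrow> Inter B (f' \<cdot> f) g
        = ((f' \<rtimes> Y') \<rhd> Inter B f g) \<bullet> (Inter B f' g \<lhd> (f \<rtimes> Y))"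
    and inter_comp_right: "\<lbrakk>f \<in> hom1 B X X'; g \<in> hom1 B Y Y'; g' \<in> hom1 B Y' Y''\<rbrakk>
      \<Longrightarrow> Inter B f (g' \<cdot> g)
        = (Inter B f g' \<lhd> (X \<ltimes> g)) \<bullet> ((X' \<ltimes> g') \<rhd> Inter B f g)"
    and inter_left: "\<lbrakk>Z \<in> Obj B; f \<in> Cell1 B; g \<in> Cell1 B\<rbrakk>
      \<Longrightarrow> Z \<ltimes>\<^sub>2 Inter B f g = Inter B (Z \<ltimes> f) g"
    and inter_mid: "\<lbrakk>Z \<in> Obj B; f \<in> Cell1 B; g \<in> Cell1 B\<rbrakk>
      \<Longrightarrow> Inter B (f \<rtimes> Z) g = Inter B f (Z \<ltimes> g)"
    and inter_right: "\<lbrakk>Z \<in> Obj B; f \<in> Cell1 B; g \<in> Cell1 B\<rbrakk>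
      \<Longrightarrow> Inter B f g \<rtimes>\<^sub>2 Z = Inter B f (g \<rtimes> Z)"


section \<open>Skew semimonoidales and their units\<close>

locale skew_semimonoidale = gray_monoid B
  for B :: "('o, 'a, 'c, 'z) gray_scheme" (structure) +
  fixes A :: 'o and p :: 'a and \<alpha> :: 'c
  assumes A_in: "A \<in> Obj B"
    and p_in: "p \<in> hom1 B (A \<otimes> A) A"
    and \<alpha>_in: "\<alpha> \<in> hom2 B (p \<cdot> (p \<rtimes> A)) (p \<cdot> (A \<ltimes> p))"
    and pentagon: "(\<alpha> \<lhd> ((A \<otimes> A) \<ltimes> p)) \<bullet> (p \<rhd> Inter B p p) \<bullet> (\<alpha> \<lhd> (p \<rtimes> (A \<otimes> A)))
      = (p \<rhd> (A \<ltimes>\<^sub>2 \<alpha>)) \<bullet> (\<alpha> \<lhd> (A \<ltimes> (p \<rtimes> A))) \<bullet> (p \<rhd> (\<alpha> \<rtimes>\<^sub>2 A))"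

definition is_unit ::
    "('o, 'a, 'c, 'z) gray_scheme \<Rightarrow> 'o \<Rightarrow> 'a \<Rightarrow> 'c \<Rightarrow> 'a \<Rightarrow> 'c \<Rightarrow> 'c \<Rightarrow> bool" where
  "is_unit B A p \<alpha> j lam \<rho> \<longleftrightarrow>
     j \<in> hom1 B (Unit B) A \<and>
     lam \<in> hom2 B (p \<cdot>\<^bsub>B\<^esub> (j \<rtimes>\<^bsub>B\<^esub> A)) (Id1 B A) \<and>
     \<rho> \<in> hom2 B (Id1 B A) (p \<cdot>\<^bsub>B\<^esub> (A \<ltimes>\<^bsub>B\<^esub> j)) \<and>
     (lam \<lhd>\<^bsub>B\<^esub> p) \<bullet>\<^bsub>B\<^esub> (p \<rhd>\<^bsub>B\<^esub> Inter B j p) \<bullet>\<^bsub>B\<^esub> (\<alpha> \<lhd>\<^bsub>B\<^esub> (j \<rtimes>\<^bsub>B\<^esub> (A \<otimes>\<^bsub>B\<^esub> A)))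
       = p \<rhd>\<^bsub>B\<^esub> (lam \<rtimes>\<^sub>2\<^bsub>B\<^esub> A) \<and>
     (\<alpha> \<lhd>\<^bsub>B\<^esub> ((A \<otimes>\<^bsub>B\<^esub> A) \<ltimes>\<^bsub>B\<^esub> j)) \<bullet>\<^bsub>B\<^esub> (p \<rhd>\<^bsub>B\<^esub> Inter B p j) \<bullet>\<^bsub>B\<^esub> (\<rho> \<lhd>\<^bsub>B\<^esub> p)
       = p \<rhd>\<^bsub>B\<^esub> (A \<ltimes>\<^sub>2\<^bsub>B\<^esub> \<rho>) \<and>
     (p \<rhd>\<^bsub>B\<^esub> (A \<ltimes>\<^sub>2\<^bsub>B\<^esub> lam)) \<bullet>\<^bsub>B\<^esub> (\<alpha> \<lhd>\<^bsub>B\<^esub> (A \<ltimes>\<^bsub>B\<^esub> (j \<rtimes>\<^bsub>B\<^esub> A))) \<bullet>\<^bsub>B\<^esub> (p \<rhd>\<^bsub>B\<^esub> (\<rho> \<rtimes>\<^sub>2\<^bsub>B\<^esub> A))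
       = Id2 B p \<and>
     (lam \<lhd>\<^bsub>B\<^esub> j) \<bullet>\<^bsub>B\<^esub> (p \<rhd>\<^bsub>B\<^esub> Inter B j j) \<bullet>\<^bsub>B\<^esub> (\<rho> \<lhd>\<^bsub>B\<^esub> j) = Id2 B j"

fun unit_hom ::
    "('o, 'a, 'c, 'z) gray_scheme \<Rightarrow> 'o \<Rightarrow> 'a \<Rightarrow> 'a \<times> 'c \<times> 'c \<Rightarrow> 'a \<times> 'c \<times> 'c \<Rightarrow> 'c set" where
  "unit_hom B A p (j', lam', \<rho>') (j, lam, \<rho>) =
     {\<phi> \<in> hom2 B j' j. lam \<bullet>\<^bsub>B\<^esub> (p \<rhd>\<^bsub>B\<^esub> (\<phi> \<rtimes>\<^sub>2\<^bsub>B\<^esub> A)) = lam' \<and>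
                       (p \<rhd>\<^bsub>B\<^esub> (A \<ltimes>\<^sub>2\<^bsub>B\<^esub> \<phi>)) \<bullet>\<^bsub>B\<^esub> \<rho>' = \<rho>}"

definition units_cat ::
    "('o, 'a, 'c, 'z) gray_scheme \<Rightarrow> 'o \<Rightarrow> 'a \<Rightarrow> 'c \<Rightarrow> ('a \<times> 'c \<times> 'c, 'c) cat" where
  "units_cat B A p \<alpha> =
     \<lparr> CObj = {(j, lam, \<rho>). is_unit B A p \<alpha> j lam \<rho>},
       CHom = unit_hom B A p,
       CId = (\<lambda>(j, lam, \<rho>). Id2 B j),
       CComp = (\<lambda>\<psi> \<phi>. \<psi> \<bullet>\<^bsub>B\<^esub> \<phi>) \<rparr>"

locale skew_monoidale = skew_semimonoidale B A p \<alpha>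
  for B :: "('o, 'a, 'c, 'z) gray_scheme" (structure)
    and A :: 'o and p :: 'a and j :: 'a and \<alpha> :: 'c and lam :: 'c and \<rho> :: 'c +
  assumes unit: "(j, lam, \<rho>) \<in> CObj (units_cat B A p \<alpha>)"

lemma (in two_category) hom2_cells:
  "\<phi> \<in> hom2 B f g \<Longrightarrow> f \<in> hom1 B X Y \<Longrightarrow> g \<in> hom1 B X Y"
  "\<phi> \<in> hom2 B f g \<Longrightarrow> g \<in> hom1 B X Y \<Longrightarrow> f \<in> hom1 B X Y"
  using dom_cod[of \<phi>] by (auto simp: hom2_def hom1_def)

lemma (in two_category) lwhisker_in:
  "\<lbrakk>\<phi> \<in> hom2 B f g; f \<in> hom1 B X Y; h \<in> hom1 B Y Z\<rbrakk> \<Longrightarrow> h \<rhd> \<phi> \<in> hom2 B (h \<cdot> f) (h \<cdot> g)"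
  unfolding lwhisker_def
  by (rule hcomp_in[of f X Y g h Z h]) (simp_all add: hom2_cells id2_in hom1_def[of B Y Z])

lemma (in two_category) lwhisker_vcomp:
  assumes "\<phi> \<in> hom2 B f g" "\<psi> \<in> hom2 B g k" "f \<in> hom1 B X Y" "h \<in> hom1 B Y Z"
  shows "h \<rhd> (\<psi> \<bullet> \<phi>) = (h \<rhd> \<psi>) \<bullet> (h \<rhd> \<phi>)"
proof -
  have g: "g \<in> hom1 B X Y" and k: "k \<in> hom1 B X Y"
    using assms hom2_cells by blast+
  have h: "Id2 B h \<in> hom2 B h h" using assms(4) id2_in by (simp add: hom1_def)
  show ?thesis unfolding lwhisker_def
    using interchange[OF assms(3) g k assms(4) assms(4) assms(4) assms(1,2) h h] id2_left[OF h]
    by simp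
qed

lemma (in two_category) lwhisker_id2:
  "\<lbrakk>f \<in> hom1 B X Y; h \<in> hom1 B Y Z\<rbrakk> \<Longrightarrow> h \<rhd> Id2 B f = Id2 B (h \<cdot> f)"
  unfolding lwhisker_def by (rule hcomp_id2)

theorem (in skew_semimonoidale) category_units_cat: "category (units_cat B A p \<alpha>)"
proof -
  interpret L: two_functor B B "\<lambda>Y. A \<otimes> Y" "\<lambda>g. A \<ltimes> g" "\<lambda>\<psi>. A \<ltimes>\<^sub>2 \<psi>"
    by (rule left_functor[OF A_in])
  interpret R: two_functor B B "\<lambda>X. X \<otimes> A" "\<lambda>f. f \<rtimes> A" "\<lambda>\<phi>. \<phi> \<rtimes>\<^sub>2 A"
    by (rule right_functor[OF A_in])
  have Lj: "A \<ltimes> j \<in> hom1 B A (A \<otimes> A)" and Rj: "j \<rtimes> A \<in> hom1 B A (A \<otimes> A)"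
    and j1: "j \<in> Cell1 B" if "j \<in> hom1 B (Unit B) A" for j
    using L.F1_in[OF that] R.F1_in[OF that] that
    by (simp_all add: unit_left0 unit_right0 A_in hom1_def)
  have id: "Id2 B j \<in> unit_hom B A p (j, lam, \<rho>) (j, lam, \<rho>)"
    if "is_unit B A p \<alpha> j lam \<rho>" for j lam \<rho>
    using that Lj[of j] Rj[of j] j1[of j] p_in
    by (auto simp: is_unit_def id2_in L.F2_id R.F2_id lwhisker_id2 id2_left id2_right)
  have comp: "\<psi> \<bullet> \<phi> \<in> unit_hom B A p (j\<^sub>1, lam\<^sub>1, \<rho>\<^sub>1) (j\<^sub>3, lam\<^sub>3, \<rho>\<^sub>3)"
    if u1: "is_unit B A p \<alpha> j\<^sub>1 lam\<^sub>1 \<rho>\<^sub>1" and u2: "is_unit B A p \<alpha> j\<^sub>2 lam\<^sub>2 \<rho>\<^sub>2"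
      and u3: "is_unit B A p \<alpha> j\<^sub>3 lam\<^sub>3 \<rho>\<^sub>3"
      and f: "\<phi> \<in> unit_hom B A p (j\<^sub>1, lam\<^sub>1, \<rho>\<^sub>1) (j\<^sub>2, lam\<^sub>2, \<rho>\<^sub>2)"
      and g: "\<psi> \<in> unit_hom B A p (j\<^sub>2, lam\<^sub>2, \<rho>\<^sub>2) (j\<^sub>3, lam\<^sub>3, \<rho>\<^sub>3)"
    for j\<^sub>1 lam\<^sub>1 \<rho>\<^sub>1 j\<^sub>2 lam\<^sub>2 \<rho>\<^sub>2 j\<^sub>3 lam\<^sub>3 \<rho>\<^sub>3 \<phi> \<psi>
  proof -
    have \<phi>: "\<phi> \<in> hom2 B j\<^sub>1 j\<^sub>2" and \<psi>: "\<psi> \<in> hom2 B j\<^sub>2 j\<^sub>3" using f g by auto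
    have j: "j\<^sub>1 \<in> hom1 B (Unit B) A" "j\<^sub>2 \<in> hom1 B (Unit B) A"
      using u1 u2 by (auto simp: is_unit_def)
    have lam3: "lam\<^sub>3 \<in> hom2 B (p \<cdot> (j\<^sub>3 \<rtimes> A)) (Id1 B A)"
      and rho1: "\<rho>\<^sub>1 \<in> hom2 B (Id1 B A) (p \<cdot> (A \<ltimes> j\<^sub>1))"
      using u1 u3 by (auto simp: is_unit_def)
    note R1 = lwhisker_in[OF R.F2_in[OF \<phi>] Rj[OF j(1)] p_in]
    note R2 = lwhisker_in[OF R.F2_in[OF \<psi>] Rj[OF j(2)] p_in]
    note L1 = lwhisker_in[OF L.F2_in[OF \<phi>] Lj[OF j(1)] p_in]
    note L2 = lwhisker_in[OF L.F2_in[OF \<psi>] Lj[OF j(2)] p_in]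
    have "p \<rhd> ((\<psi> \<bullet> \<phi>) \<rtimes>\<^sub>2 A) = (p \<rhd> (\<psi> \<rtimes>\<^sub>2 A)) \<bullet> (p \<rhd> (\<phi> \<rtimes>\<^sub>2 A))"
      using lwhisker_vcomp[OF R.F2_in[OF \<phi>] R.F2_in[OF \<psi>] Rj[OF j(1)] p_in]
      by (simp add: R.F2_vcomp[OF \<phi> \<psi>])
    then have 1: "lam\<^sub>3 \<bullet> (p \<rhd> ((\<psi> \<bullet> \<phi>) \<rtimes>\<^sub>2 A)) = lam\<^sub>1"
      using vcomp_assoc[OF R1 R2 lam3] f g by simp
    have "p \<rhd> (A \<ltimes>\<^sub>2 (\<psi> \<bullet> \<phi>)) = (p \<rhd> (A \<ltimes>\<^sub>2 \<psi>)) \<bullet> (p \<rhd> (A \<ltimes>\<^sub>2 \<phi>))"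
      using lwhisker_vcomp[OF L.F2_in[OF \<phi>] L.F2_in[OF \<psi>] Lj[OF j(1)] p_in]
      by (simp add: L.F2_vcomp[OF \<phi> \<psi>])
    then have 2: "(p \<rhd> (A \<ltimes>\<^sub>2 (\<psi> \<bullet> \<phi>))) \<bullet> \<rho>\<^sub>1 = \<rho>\<^sub>3"
      using vcomp_assoc[OF rho1 L1 L2] f g by simp
    show ?thesis using 1 2 vcomp_in[OF \<phi> \<psi>] by simp
  qed
  have hom2: "\<phi> \<in> hom2 B (fst x) (fst y)" if "\<phi> \<in> unit_hom B A p x y" for \<phi> x y
    using that by (cases x; cases y) auto
  show ?thesis
  proof (unfold_locales, goal_cases)
    case (1 x)
    then show ?case by (auto simp: units_cat_def intro!: id simp del: unit_hom.simps)
  next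
    case (2 x y z f g)
    then show ?case
      by (cases x; cases y; cases z) (auto simp: units_cat_def simp del: unit_hom.simps intro: comp)
  next
    case (3 x y f)
    then show ?case by (auto simp: units_cat_def simp del: unit_hom.simps dest!: hom2 intro: id2_left)
  next
    case (4 x y f)
    then show ?case by (auto simp: units_cat_def simp del: unit_hom.simps dest!: hom2 intro: id2_right)
  next
    case (5 w x y z f g h)
    then show ?case
      by (auto simp: units_cat_def simp del: unit_hom.simps dest!: hom2 intro: vcomp_assoc)
  qed
qed

end

theory Submission
  imports Defs
begin

text \<open>
  Between any two units there is exactly one morphism of units. Once this is known, the two
  composites of the morphisms between \<open>j\<^sub>1\<close> and \<open>j\<^sub>2\<close> are endomorphisms and so are identities, and
  uniqueness of the isomorphism is a special case (\<open>ex1_isomorphism_if_indiscrete\<close>).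

  In an ordinary skew monoidal category, where \<open>\<lambda> : j x \<rightarrow> x\<close> and \<open>\<rho> : x \<rightarrow> x j\<close>, the morphism is the
  composite \<open>j\<^sub>1 \<rightarrow> j\<^sub>1 j\<^sub>2 \<rightarrow> j\<^sub>2\<close> of \<open>\<rho>\<^sub>2\<close> and \<open>\<lambda>\<^sub>1\<close>. It respects \<open>\<lambda>\<close> because the path
  \<open>j\<^sub>1 x \<rightarrow> (j\<^sub>1 j\<^sub>2) x \<rightarrow> j\<^sub>2 x \<rightarrow> x\<close> equals \<open>j\<^sub>1 x \<rightarrow> (j\<^sub>1 j\<^sub>2) x \<rightarrow> j\<^sub>1 (j\<^sub>2 x) \<rightarrow> j\<^sub>1 x \<rightarrow> x\<close>, by the compatibility
  of \<open>\<lambda>\<^sub>1\<close> with \<open>\<alpha>\<close> and naturality, and the middle of the latter path, from \<open>j\<^sub>1 x\<close> to \<open>j\<^sub>1 x\<close>, is the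
  triangle for the second unit (\<open>unit_comparison_lam\<close>). Dually it respects \<open>\<rho>\<close>, by the compatibility
  of \<open>\<rho>\<^sub>2\<close> with \<open>\<alpha>\<close> and the triangle for the first unit (\<open>unit_comparison_rho\<close>). Conversely, a
  morphism \<open>\<phi>\<close> expresses \<open>\<rho>\<^sub>2\<close> at \<open>j\<^sub>1\<close> as \<open>\<rho>\<^sub>1\<close> followed by \<open>j\<^sub>1 \<phi>\<close>; by naturality of \<open>\<lambda>\<^sub>1\<close> the comparison becomes
  \<open>j\<^sub>1 \<rightarrow> j\<^sub>1 j\<^sub>1 \<rightarrow> j\<^sub>1 \<rightarrow> j\<^sub>2\<close>, whose first two arrows cancel by the last unit axiom, leaving \<open>\<phi>\<close>
  (\<open>unit_hom_eq_comparison\<close>).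

  In a Gray monoid the same argument works with two changes. Naturality of \<open>\<alpha>\<close>, \<open>\<lambda>\<close> and \<open>\<rho>\<close> in their
  arguments becomes the exchange law for whiskering, and wherever the tensor product would be
  applied to morphisms in two variables an interchange 2-cell appears; these are combined and
  removed by their composition and naturality laws.
\<close>

section \<open>Whiskering in a 2-category\<close>

text \<open>
  The axioms are restated with side conditions in terms of \<open>Src\<close>, \<open>Tgt\<close>, \<open>Dom\<close> and \<open>Cod\<close> instead of
  membership in hom-sets. The objects and 1-cells of a hom-set membership do not occur in the terms
  to be rewritten, whereas these conditions can be checked by rewriting alone, so that pasting
  composites can be normalised by the simplifier.
\<close>

context two_category
begin

lemma hom1_iff: "f \<in> hom1 B X Y \<longleftrightarrow> f \<in> Cell1 B \<and> Src B f = X \<and> Tgt B f = Y"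
  by (simp add: hom1_def)

lemma hom2_iff: "\<phi> \<in> hom2 B f g \<longleftrightarrow> \<phi> \<in> Cell2 B \<and> Dom B \<phi> = f \<and> Cod B \<phi> = g"
  by (simp add: hom2_def)

lemma cell1_boundary [simp]:
  assumes "f \<in> Cell1 B"
  shows "Src B f \<in> Obj B" and "Tgt B f \<in> Obj B"
  using src_tgt[OF assms] by simp_all

lemma id1_boundary [simp]:
  assumes "X \<in> Obj B"
  shows "Id1 B X \<in> Cell1 B" and "Src B (Id1 B X) = X" and "Tgt B (Id1 B X) = X"
  using id1_in[OF assms] by (simp_all add: hom1_iff)

lemma comp1_boundary [simp]:
  assumes "f \<in> Cell1 B" "g \<in> Cell1 B" "Tgt B f = Src B g"
  shows "g \<cdot> f \<in> Cell1 B" and "Src B (g \<cdot> f) = Src B f" and "Tgt B (g \<cdot> f) = Tgt B g"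
  using comp1_in[of f "Src B f" "Src B g" g "Tgt B g"] assms by (simp_all add: hom1_iff)

lemma comp1_monoid [simp]:
  "\<lbrakk>f \<in> Cell1 B; Tgt B f = Y\<rbrakk> \<Longrightarrow> Id1 B Y \<cdot> f = f"
  "\<lbrakk>f \<in> Cell1 B; Src B f = X\<rbrakk> \<Longrightarrow> f \<cdot> Id1 B X = f"
  "\<lbrakk>f \<in> Cell1 B; g \<in> Cell1 B; h \<in> Cell1 B; Tgt B f = Src B g; Tgt B g = Src B h\<rbrakk>
    \<Longrightarrow> (h \<cdot> g) \<cdot> f = h \<cdot> (g \<cdot> f)"
  by (auto intro: id1_left id1_right comp1_assoc simp: hom1_iff)

lemma cell2_boundary [simp]:
  assumes "\<phi> \<in> Cell2 B"
  shows "Dom B \<phi> \<in> Cell1 B" and "Cod B \<phi> \<in> Cell1 B"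
    and "Src B (Cod B \<phi>) = Src B (Dom B \<phi>)" and "Tgt B (Cod B \<phi>) = Tgt B (Dom B \<phi>)"
  using dom_cod[OF assms] by simp_all

lemma id2_boundary [simp]:
  assumes "f \<in> Cell1 B"
  shows "Id2 B f \<in> Cell2 B" and "Dom B (Id2 B f) = f" and "Cod B (Id2 B f) = f"
  using id2_in[OF assms] by (simp_all add: hom2_iff)

lemma vcomp_boundary [simp]:
  assumes "\<phi> \<in> Cell2 B" "\<psi> \<in> Cell2 B" "Cod B \<phi> = Dom B \<psi>"
  shows "\<psi> \<bullet> \<phi> \<in> Cell2 B" and "Dom B (\<psi> \<bullet> \<phi>) = Dom B \<phi>" and "Cod B (\<psi> \<bullet> \<phi>) = Cod B \<psi>"
  using vcomp_in[of \<phi> "Dom B \<phi>" "Dom B \<psi>" \<psi> "Cod B \<psi>"] assms by (simp_all add: hom2_iff)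

lemma vcomp_monoid [simp]:
  "\<lbrakk>\<phi> \<in> Cell2 B; Cod B \<phi> = g\<rbrakk> \<Longrightarrow> Id2 B g \<bullet> \<phi> = \<phi>"
  "\<lbrakk>\<phi> \<in> Cell2 B; Dom B \<phi> = f\<rbrakk> \<Longrightarrow> \<phi> \<bullet> Id2 B f = \<phi>"
  "\<lbrakk>\<phi> \<in> Cell2 B; \<psi> \<in> Cell2 B; \<chi> \<in> Cell2 B; Cod B \<phi> = Dom B \<psi>; Cod B \<psi> = Dom B \<chi>\<rbrakk>
    \<Longrightarrow> (\<chi> \<bullet> \<psi>) \<bullet> \<phi> = \<chi> \<bullet> (\<psi> \<bullet> \<phi>)"
  by (auto intro: id2_left id2_right vcomp_assoc simp: hom2_iff)

lemma hcomp_boundary: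
  assumes "\<phi> \<in> Cell2 B" "\<psi> \<in> Cell2 B" "Tgt B (Dom B \<phi>) = Src B (Dom B \<psi>)"
  shows "\<psi> \<star> \<phi> \<in> Cell2 B" and "Dom B (\<psi> \<star> \<phi>) = Dom B \<psi> \<cdot> Dom B \<phi>"
    and "Cod B (\<psi> \<star> \<phi>) = Cod B \<psi> \<cdot> Cod B \<phi>"
  using hcomp_in[of "Dom B \<phi>" _ _ "Cod B \<phi>" "Dom B \<psi>" _ "Cod B \<psi>" \<phi> \<psi>] assms
  by (simp_all add: hom1_iff hom2_iff)

lemma whisker_boundary [simp]:
  assumes "\<phi> \<in> Cell2 B" "h \<in> Cell1 B"
  shows "Tgt B (Dom B \<phi>) = Src B h \<Longrightarrow> h \<rhd> \<phi> \<in> Cell2 B"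
    and "Tgt B (Dom B \<phi>) = Src B h \<Longrightarrow> Dom B (h \<rhd> \<phi>) = h \<cdot> Dom B \<phi>"
    and "Tgt B (Dom B \<phi>) = Src B h \<Longrightarrow> Cod B (h \<rhd> \<phi>) = h \<cdot> Cod B \<phi>"
    and "Tgt B h = Src B (Dom B \<phi>) \<Longrightarrow> \<phi> \<lhd> h \<in> Cell2 B"
    and "Tgt B h = Src B (Dom B \<phi>) \<Longrightarrow> Dom B (\<phi> \<lhd> h) = Dom B \<phi> \<cdot> h"
    and "Tgt B h = Src B (Dom B \<phi>) \<Longrightarrow> Cod B (\<phi> \<lhd> h) = Cod B \<phi> \<cdot> h"
  using assms by (simp_all add: lwhisker_def rwhisker_def hcomp_boundary)

lemma interchange_boundary:
  assumes "\<phi> \<in> Cell2 B" "\<phi>' \<in> Cell2 B" "\<psi> \<in> Cell2 B" "\<psi>' \<in> Cell2 B"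
    "Cod B \<phi> = Dom B \<phi>'" "Cod B \<psi> = Dom B \<psi>'" "Tgt B (Dom B \<phi>) = Src B (Dom B \<psi>)"
  shows "(\<psi>' \<star> \<phi>') \<bullet> (\<psi> \<star> \<phi>) = (\<psi>' \<bullet> \<psi>) \<star> (\<phi>' \<bullet> \<phi>)"
proof -
  have "Src B (Dom B \<phi>') = Src B (Dom B \<phi>)" "Tgt B (Dom B \<phi>') = Tgt B (Dom B \<phi>)"
    "Src B (Dom B \<psi>') = Src B (Dom B \<psi>)" "Tgt B (Dom B \<psi>') = Tgt B (Dom B \<psi>)"
    using assms cell2_boundary[of \<phi>] cell2_boundary[of \<psi>] by simp_all
  then show ?thesis
    by (intro interchange[symmetric, of "Dom B \<phi>" "Src B (Dom B \<phi>)" "Tgt B (Dom B \<phi>)"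
          "Dom B \<phi>'" "Cod B \<phi>'" "Dom B \<psi>" "Tgt B (Dom B \<psi>)" "Dom B \<psi>'" "Cod B \<psi>'"])
      (use assms in \<open>simp_all add: hom1_iff hom2_iff\<close>)
qed

lemma hcomp_assoc_boundary:
  assumes "\<phi> \<in> Cell2 B" "\<psi> \<in> Cell2 B" "\<chi> \<in> Cell2 B"
    "Tgt B (Dom B \<phi>) = Src B (Dom B \<psi>)" "Tgt B (Dom B \<psi>) = Src B (Dom B \<chi>)"
  shows "(\<chi> \<star> \<psi>) \<star> \<phi> = \<chi> \<star> (\<psi> \<star> \<phi>)"
  by (rule hcomp_assoc[of "Dom B \<phi>" "Src B (Dom B \<phi>)" "Src B (Dom B \<psi>)" "Cod B \<phi>"
        "Dom B \<psi>" "Src B (Dom B \<chi>)" "Cod B \<psi>" "Dom B \<chi>" "Tgt B (Dom B \<chi>)" "Cod B \<chi>"])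
    (use assms in \<open>simp_all add: hom1_iff hom2_iff\<close>)

lemma whisker_distrib [simp]:
  assumes "\<phi> \<in> Cell2 B" "\<psi> \<in> Cell2 B" "h \<in> Cell1 B" "Cod B \<phi> = Dom B \<psi>"
  shows "Tgt B (Dom B \<phi>) = Src B h \<Longrightarrow> h \<rhd> (\<psi> \<bullet> \<phi>) = (h \<rhd> \<psi>) \<bullet> (h \<rhd> \<phi>)"
    and "Tgt B h = Src B (Dom B \<phi>) \<Longrightarrow> (\<psi> \<bullet> \<phi>) \<lhd> h = (\<psi> \<lhd> h) \<bullet> (\<phi> \<lhd> h)"
  using assms by (simp_all add: lwhisker_def rwhisker_def interchange_boundary)

lemma whisker_id2 [simp]:
  assumes "f \<in> Cell1 B" "g \<in> Cell1 B" "Tgt B f = Src B g"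
  shows "g \<rhd> Id2 B f = Id2 B (g \<cdot> f)" and "Id2 B g \<lhd> f = Id2 B (g \<cdot> f)"
  using hcomp_id2[of f "Src B f" "Src B g" g "Tgt B g"] assms
  by (simp_all add: hom1_iff lwhisker_def rwhisker_def)

lemma whisker_id1 [simp]:
  assumes "\<phi> \<in> Cell2 B"
  shows "Tgt B (Dom B \<phi>) = Y \<Longrightarrow> Id1 B Y \<rhd> \<phi> = \<phi>"
    and "Src B (Dom B \<phi>) = X \<Longrightarrow> \<phi> \<lhd> Id1 B X = \<phi>"
  using hcomp_id_left[of "Dom B \<phi>" _ _ "Cod B \<phi>" \<phi>]
    hcomp_id_right[of "Dom B \<phi>" _ _ "Cod B \<phi>" \<phi>] assms
  by (simp_all add: hom1_iff hom2_iff lwhisker_def rwhisker_def)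

text \<open>
  Used as rewrite rules, these turn every iterated whiskering into the form \<open>h \<rhd> (\<phi> \<lhd> f)\<close>, so
  that, together with distributivity, two pasting composites that differ only in bracketing
  become syntactically equal.
\<close>

lemma whisker_assoc [simp]:
  assumes "\<phi> \<in> Cell2 B" "h \<in> Cell1 B" "k \<in> Cell1 B"
  shows "\<lbrakk>Tgt B (Dom B \<phi>) = Src B h; Tgt B h = Src B k\<rbrakk> \<Longrightarrow> k \<rhd> (h \<rhd> \<phi>) = (k \<cdot> h) \<rhd> \<phi>"
    and "\<lbrakk>Tgt B h = Src B (Dom B \<phi>); Tgt B k = Src B h\<rbrakk> \<Longrightarrow> (\<phi> \<lhd> h) \<lhd> k = \<phi> \<lhd> (h \<cdot> k)"
    and "\<lbrakk>Tgt B (Dom B \<phi>) = Src B h; Tgt B k = Src B (Dom B \<phi>)\<rbrakk>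
      \<Longrightarrow> (h \<rhd> \<phi>) \<lhd> k = h \<rhd> (\<phi> \<lhd> k)"
proof -
  assume "Tgt B (Dom B \<phi>) = Src B h" "Tgt B h = Src B k"
  then show "k \<rhd> (h \<rhd> \<phi>) = (k \<cdot> h) \<rhd> \<phi>"
    using assms whisker_id2(1)[of h k] unfolding lwhisker_def
    by (metis hcomp_assoc_boundary id2_boundary)
next
  assume "Tgt B h = Src B (Dom B \<phi>)" "Tgt B k = Src B h"
  then show "(\<phi> \<lhd> h) \<lhd> k = \<phi> \<lhd> (h \<cdot> k)"
    using assms whisker_id2(2)[of k h] unfolding rwhisker_def
    by (metis hcomp_assoc_boundary id2_boundary)
next
  assume "Tgt B (Dom B \<phi>) = Src B h" "Tgt B k = Src B (Dom B \<phi>)"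
  then show "(h \<rhd> \<phi>) \<lhd> k = h \<rhd> (\<phi> \<lhd> k)"
    using assms by (simp add: lwhisker_def rwhisker_def hcomp_assoc_boundary)
qed

text \<open>Both composites are the horizontal composite \<open>\<beta> \<star> \<gamma>\<close>.\<close>

lemma whisker_exchange:
  assumes "\<gamma> \<in> hom2 B f f'" "\<beta> \<in> hom2 B g g'" "Tgt B f = Src B g"
  shows "(\<beta> \<lhd> f') \<bullet> (g \<rhd> \<gamma>) = (g' \<rhd> \<gamma>) \<bullet> (\<beta> \<lhd> f)"
proof -
  have "\<gamma> \<in> Cell2 B" "\<beta> \<in> Cell2 B" "f = Dom B \<gamma>" "f' = Cod B \<gamma>" "g = Dom B \<beta>" "g' = Cod B \<beta>"
    using assms by (auto simp: hom2_iff)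
  then show ?thesis
    using assms(3) by (simp add: lwhisker_def rwhisker_def interchange_boundary)
qed

end

section \<open>Tensoring and interchange in a Gray monoid\<close>

context gray_monoid
begin

lemma tensor_boundary1 [simp]:
  assumes "X \<in> Obj B" "f \<in> Cell1 B"
  shows "X \<ltimes> f \<in> Cell1 B" "Src B (X \<ltimes> f) = X \<otimes> Src B f" "Tgt B (X \<ltimes> f) = X \<otimes> Tgt B f"
    and "f \<rtimes> X \<in> Cell1 B" "Src B (f \<rtimes> X) = Src B f \<otimes> X" "Tgt B (f \<rtimes> X) = Tgt B f \<otimes> X"
  using two_functor.F1_in[OF left_functor, of X f "Src B f" "Tgt B f"]
    two_functor.F1_in[OF right_functor, of X f "Src B f" "Tgt B f"] assms
  by (simp_all add: hom1_iff)

lemma tensor_obj [simp]: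
  assumes "X \<in> Obj B" "Y \<in> Obj B"
  shows "X \<otimes> Y \<in> Obj B"
  by (rule two_functor.F0_in[OF left_functor[OF assms(1)] assms(2)])

lemma tensor_boundary2 [simp]:
  assumes "X \<in> Obj B" "\<phi> \<in> Cell2 B"
  shows "X \<ltimes>\<^sub>2 \<phi> \<in> Cell2 B" "Dom B (X \<ltimes>\<^sub>2 \<phi>) = X \<ltimes> Dom B \<phi>" "Cod B (X \<ltimes>\<^sub>2 \<phi>) = X \<ltimes> Cod B \<phi>"
    and "\<phi> \<rtimes>\<^sub>2 X \<in> Cell2 B" "Dom B (\<phi> \<rtimes>\<^sub>2 X) = Dom B \<phi> \<rtimes> X" "Cod B (\<phi> \<rtimes>\<^sub>2 X) = Cod B \<phi> \<rtimes> X"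
  using two_functor.F2_in[OF left_functor, of X \<phi> "Dom B \<phi>" "Cod B \<phi>"]
    two_functor.F2_in[OF right_functor, of X \<phi> "Dom B \<phi>" "Cod B \<phi>"] assms
  by (simp_all add: hom2_iff)

lemma tensor_id1 [simp]:
  assumes "X \<in> Obj B" "Y \<in> Obj B"
  shows "X \<ltimes> Id1 B Y = Id1 B (X \<otimes> Y)" and "Id1 B X \<rtimes> Y = Id1 B (X \<otimes> Y)"
  by (rule two_functor.F1_id[OF left_functor[OF assms(1)] assms(2)],
      rule two_functor.F1_id[OF right_functor[OF assms(2)] assms(1)])

lemma tensor_comp1 [simp]:
  assumes "X \<in> Obj B" "f \<in> Cell1 B" "g \<in> Cell1 B" "Tgt B f = Src B g"
  shows "X \<ltimes> (g \<cdot> f) = (X \<ltimes> g) \<cdot> (X \<ltimes> f)" and "(g \<cdot> f) \<rtimes> X = (g \<rtimes> X) \<cdot> (f \<rtimes> X)"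
  using two_functor.F1_comp[OF left_functor, of X f "Src B f" "Src B g" g "Tgt B g"]
    two_functor.F1_comp[OF right_functor, of X f "Src B f" "Src B g" g "Tgt B g"] assms
  by (simp_all add: hom1_iff)

lemma tensor_vcomp [simp]:
  assumes "X \<in> Obj B" "\<phi> \<in> Cell2 B" "\<psi> \<in> Cell2 B" "Cod B \<phi> = Dom B \<psi>"
  shows "X \<ltimes>\<^sub>2 (\<psi> \<bullet> \<phi>) = (X \<ltimes>\<^sub>2 \<psi>) \<bullet> (X \<ltimes>\<^sub>2 \<phi>)" and "(\<psi> \<bullet> \<phi>) \<rtimes>\<^sub>2 X = (\<psi> \<rtimes>\<^sub>2 X) \<bullet> (\<phi> \<rtimes>\<^sub>2 X)"
  using two_functor.F2_vcomp[OF left_functor, of X \<phi> "Dom B \<phi>" "Dom B \<psi>" \<psi> "Cod B \<psi>"]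
    two_functor.F2_vcomp[OF right_functor, of X \<phi> "Dom B \<phi>" "Dom B \<psi>" \<psi> "Cod B \<psi>"] assms
  by (simp_all add: hom2_iff)

lemma tensor_hcomp:
  assumes "X \<in> Obj B" "\<phi> \<in> Cell2 B" "\<psi> \<in> Cell2 B" "Tgt B (Dom B \<phi>) = Src B (Dom B \<psi>)"
  shows "X \<ltimes>\<^sub>2 (\<psi> \<star> \<phi>) = (X \<ltimes>\<^sub>2 \<psi>) \<star> (X \<ltimes>\<^sub>2 \<phi>)" and "(\<psi> \<star> \<phi>) \<rtimes>\<^sub>2 X = (\<psi> \<rtimes>\<^sub>2 X) \<star> (\<phi> \<rtimes>\<^sub>2 X)"
  using two_functor.F2_hcomp[OF left_functor, of X "Dom B \<phi>" "Src B (Dom B \<phi>)"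
      "Tgt B (Dom B \<phi>)" "Cod B \<phi>" "Dom B \<psi>" "Tgt B (Dom B \<psi>)" "Cod B \<psi>" \<phi> \<psi>]
    two_functor.F2_hcomp[OF right_functor, of X "Dom B \<phi>" "Src B (Dom B \<phi>)"
      "Tgt B (Dom B \<phi>)" "Cod B \<phi>" "Dom B \<psi>" "Tgt B (Dom B \<psi>)" "Cod B \<psi>" \<phi> \<psi>] assms
  by (simp_all add: hom1_iff hom2_iff)

lemma tensor_id2:
  assumes "X \<in> Obj B" "f \<in> Cell1 B"
  shows "X \<ltimes>\<^sub>2 Id2 B f = Id2 B (X \<ltimes> f)" and "Id2 B f \<rtimes>\<^sub>2 X = Id2 B (f \<rtimes> X)"
  by (rule two_functor.F2_id[OF left_functor[OF assms(1)] assms(2)],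
      rule two_functor.F2_id[OF right_functor[OF assms(1)] assms(2)])

lemma tensor_whisker [simp]:
  assumes "X \<in> Obj B" "\<phi> \<in> Cell2 B" "h \<in> Cell1 B"
  shows "Tgt B (Dom B \<phi>) = Src B h \<Longrightarrow> X \<ltimes>\<^sub>2 (h \<rhd> \<phi>) = (X \<ltimes> h) \<rhd> (X \<ltimes>\<^sub>2 \<phi>)"
    and "Tgt B (Dom B \<phi>) = Src B h \<Longrightarrow> (h \<rhd> \<phi>) \<rtimes>\<^sub>2 X = (h \<rtimes> X) \<rhd> (\<phi> \<rtimes>\<^sub>2 X)"
    and "Tgt B h = Src B (Dom B \<phi>) \<Longrightarrow> X \<ltimes>\<^sub>2 (\<phi> \<lhd> h) = (X \<ltimes>\<^sub>2 \<phi>) \<lhd> (X \<ltimes> h)"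
    and "Tgt B h = Src B (Dom B \<phi>) \<Longrightarrow> (\<phi> \<lhd> h) \<rtimes>\<^sub>2 X = (\<phi> \<rtimes>\<^sub>2 X) \<lhd> (h \<rtimes> X)"
  using assms by (simp_all add: lwhisker_def rwhisker_def tensor_hcomp tensor_id2)

text \<open>
  As rewrite rules these merge iterated tensoring with objects, place left tensoring outside right
  tensoring, and absorb it into the arguments of interchange 2-cells; this is the form in which the
  unit axioms are written.
\<close>

lemmas [simp] = unit_in unit_left0 unit_left1 unit_left2 unit_right0 unit_right1 unit_right2
  assoc0 assoc_left1 assoc_right1 assoc_mid1 inter_left inter_right

lemma inter_boundary [simp]:
  assumes "f \<in> Cell1 B" "g \<in> Cell1 B"
  shows "Inter B f g \<in> Cell2 B"
    and "Dom B (Inter B f g) = (Tgt B f \<ltimes> g) \<cdot> (f \<rtimes> Src B g)"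
    and "Cod B (Inter B f g) = (f \<rtimes> Tgt B g) \<cdot> (Src B f \<ltimes> g)"
  using inter_in[of f "Src B f" "Tgt B f" g "Src B g" "Tgt B g"] assms
  by (simp_all add: hom1_iff hom2_iff)

lemma inter_natural_left:
  assumes "\<phi> \<in> hom2 B f f'" "f \<in> hom1 B X X'" "g \<in> hom1 B Y Y'"
  shows "Inter B f' g \<bullet> ((X' \<ltimes> g) \<rhd> (\<phi> \<rtimes>\<^sub>2 Y)) = ((\<phi> \<rtimes>\<^sub>2 Y') \<lhd> (X \<ltimes> g)) \<bullet> Inter B f g"
proof -
  have X: "X \<in> Obj B" "X' \<in> Obj B" using assms(2) by (auto simp: hom1_iff)
  have g: "g \<in> Cell1 B" "Id2 B g \<in> hom2 B g g"
    using assms(3) id2_in by (auto simp: hom1_iff)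
  show ?thesis
    using inter_natural[OF assms(2) hom2_cells(1)[OF assms(1,2)] assms(3,3) assms(1) g(2)]
    by (simp add: lwhisker_def rwhisker_def tensor_id2 X g)
qed

lemma inter_natural_right:
  assumes "\<psi> \<in> hom2 B g g'" "g \<in> hom1 B Y Y'" "f \<in> hom1 B X X'"
  shows "Inter B f g' \<bullet> ((X' \<ltimes>\<^sub>2 \<psi>) \<lhd> (f \<rtimes> Y)) = ((f \<rtimes> Y') \<rhd> (X \<ltimes>\<^sub>2 \<psi>)) \<bullet> Inter B f g"
proof -
  have Y: "Y \<in> Obj B" "Y' \<in> Obj B" using assms(2) by (auto simp: hom1_iff)
  have f: "f \<in> Cell1 B" "Id2 B f \<in> hom2 B f f"
    using assms(3) id2_in by (auto simp: hom1_iff)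
  show ?thesis
    using inter_natural[OF assms(3,3,2) hom2_cells(1)[OF assms(1,2)] f(2) assms(1)]
    by (simp add: lwhisker_def rwhisker_def tensor_id2 Y f)
qed

end

section \<open>Comparing two units\<close>

context skew_semimonoidale
begin

lemma semimonoidale_boundary [simp]:
  "A \<in> Obj B"
  "p \<in> Cell1 B" "Src B p = A \<otimes> A" "Tgt B p = A"
  "\<alpha> \<in> Cell2 B" "Dom B \<alpha> = p \<cdot> (p \<rtimes> A)" "Cod B \<alpha> = p \<cdot> (A \<ltimes> p)"
  using A_in p_in \<alpha>_in by (auto simp: hom1_iff hom2_iff)

lemma unit_boundary:
  assumes "is_unit B A p \<alpha> j lam \<rho>"
  shows "j \<in> Cell1 B" "Src B j = Unit B" "Tgt B j = A"
    "lam \<in> Cell2 B" "Dom B lam = p \<cdot> (j \<rtimes> A)" "Cod B lam = Id1 B A"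
    "\<rho> \<in> Cell2 B" "Dom B \<rho> = Id1 B A" "Cod B \<rho> = p \<cdot> (A \<ltimes> j)"
  using assms by (auto simp: is_unit_def hom1_iff hom2_iff)

text \<open>
  The Gray-monoid form of the composite \<open>j\<^sub>1 \<rightarrow> j\<^sub>1 j\<^sub>2 \<rightarrow> j\<^sub>2\<close> of \<open>\<rho>\<^sub>2\<close> and \<open>\<lambda>\<^sub>1\<close>: the product \<open>j\<^sub>1 j\<^sub>2\<close> arises
  from \<open>\<rho>\<^sub>2\<close> as \<open>p (1 \<otimes> j\<^sub>2) j\<^sub>1\<close>, while \<open>\<lambda>\<^sub>1\<close> expects \<open>p (j\<^sub>1 \<otimes> 1) j\<^sub>2\<close>, and the interchange 2-cell
  mediates between them.
\<close>

definition unit_comparison :: "'a \<Rightarrow> 'c \<Rightarrow> 'a \<Rightarrow> 'c \<Rightarrow> 'c" where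
  "unit_comparison j\<^sub>1 lam\<^sub>1 j\<^sub>2 \<rho>\<^sub>2 = (lam\<^sub>1 \<lhd> j\<^sub>2) \<bullet> (p \<rhd> Inter B j\<^sub>1 j\<^sub>2) \<bullet> (\<rho>\<^sub>2 \<lhd> j\<^sub>1)"

lemma unit_comparison_in:
  assumes "is_unit B A p \<alpha> j\<^sub>1 lam\<^sub>1 \<rho>\<^sub>1" "is_unit B A p \<alpha> j\<^sub>2 lam\<^sub>2 \<rho>\<^sub>2"
  shows "unit_comparison j\<^sub>1 lam\<^sub>1 j\<^sub>2 \<rho>\<^sub>2 \<in> hom2 B j\<^sub>1 j\<^sub>2"
  using unit_boundary[OF assms(1)] unit_boundary[OF assms(2)]
  by (simp add: unit_comparison_def hom2_iff)

text \<open>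
  Compatibility of \<open>\<lambda>\<^sub>1\<close> with \<open>\<alpha>\<close> replaces \<open>\<lambda>\<^sub>1 \<otimes> 1\<close> by \<open>\<alpha>\<close> followed by \<open>\<lambda>\<^sub>1\<close>. Sliding \<open>\<lambda>\<^sub>2\<close> past \<open>\<lambda>\<^sub>1\<close> and
  through the interchange 2-cells brings it next to \<open>\<alpha>\<close> and \<open>\<rho>\<^sub>2\<close>, where the triangle for the second
  unit cancels all three.
\<close>

lemma unit_comparison_lam:
  assumes u1: "is_unit B A p \<alpha> j\<^sub>1 lam\<^sub>1 \<rho>\<^sub>1" and u2: "is_unit B A p \<alpha> j\<^sub>2 lam\<^sub>2 \<rho>\<^sub>2"
  shows "lam\<^sub>2 \<bullet> (p \<rhd> (unit_comparison j\<^sub>1 lam\<^sub>1 j\<^sub>2 \<rho>\<^sub>2 \<rtimes>\<^sub>2 A)) = lam\<^sub>1"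
proof -
  note [simp] = unit_boundary[OF u1] unit_boundary[OF u2]
  let ?J1 = "j\<^sub>1 \<rtimes> A" and ?J2 = "j\<^sub>2 \<rtimes> A" and ?c = "Inter B j\<^sub>1 (j\<^sub>2 \<rtimes> A)"
  have lam1_assoc: "p \<rhd> ((lam\<^sub>1 \<rtimes>\<^sub>2 A) \<lhd> ?J2)
      = (lam\<^sub>1 \<lhd> (p \<cdot> ?J2)) \<bullet> (p \<rhd> (Inter B j\<^sub>1 p \<lhd> ?J2)) \<bullet> (\<alpha> \<lhd> ((j\<^sub>1 \<rtimes> (A \<otimes> A)) \<cdot> ?J2))"
  proof -
    have "(p \<rhd> (lam\<^sub>1 \<rtimes>\<^sub>2 A)) \<lhd> ?J2
        = ((lam\<^sub>1 \<lhd> p) \<bullet> (p \<rhd> Inter B j\<^sub>1 p) \<bullet> (\<alpha> \<lhd> (j\<^sub>1 \<rtimes> (A \<otimes> A)))) \<lhd> ?J2"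
      using u1 by (simp only: is_unit_def)
    then show ?thesis by simp
  qed
  have alpha_slide: "(\<alpha> \<lhd> ((j\<^sub>1 \<rtimes> (A \<otimes> A)) \<cdot> ?J2)) \<bullet> ((p \<cdot> (p \<rtimes> A)) \<rhd> ?c)
      = ((p \<cdot> (A \<ltimes> p)) \<rhd> ?c) \<bullet> (\<alpha> \<lhd> ((A \<ltimes> ?J2) \<cdot> ?J1))"
    by (rule whisker_exchange) (simp_all add: hom2_iff)
  \<comment> \<open>The interchange of \<open>j\<^sub>1\<close> with \<open>p\<close> from the unit axiom and that of \<open>j\<^sub>1\<close> with \<open>j\<^sub>2 \<otimes> 1\<close> from the
      comparison compose to an interchange with the domain of \<open>\<lambda>\<^sub>2\<close>, so that \<open>\<lambda>\<^sub>2\<close> can pass.\<close>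
  have inter_merge: "(p \<rhd> (Inter B j\<^sub>1 p \<lhd> ?J2)) \<bullet> ((p \<cdot> (A \<ltimes> p)) \<rhd> ?c)
      = p \<rhd> Inter B j\<^sub>1 (p \<cdot> ?J2)"
    using inter_comp_right[of j\<^sub>1 "Unit B" A ?J2 A "A \<otimes> A" p A] by (simp add: hom1_iff)
  have lam_slide: "lam\<^sub>2 \<bullet> (lam\<^sub>1 \<lhd> (p \<cdot> ?J2)) = lam\<^sub>1 \<bullet> ((p \<cdot> ?J1) \<rhd> lam\<^sub>2)"
    using whisker_exchange[of lam\<^sub>2 "p \<cdot> ?J2" "Id1 B A" lam\<^sub>1 "p \<cdot> ?J1" "Id1 B A"]
    by (simp add: hom2_iff)
  \<comment> \<open>The codomain of \<open>\<lambda>\<^sub>2\<close> is an identity 1-cell, so the interchange 2-cell disappears.\<close>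
  have inter_lam: "((p \<cdot> ?J1) \<rhd> lam\<^sub>2) \<bullet> (p \<rhd> Inter B j\<^sub>1 (p \<cdot> ?J2))
      = p \<rhd> ((A \<ltimes>\<^sub>2 lam\<^sub>2) \<lhd> ?J1)"
  proof -
    have "?J1 \<rhd> lam\<^sub>2 \<bullet> Inter B j\<^sub>1 (p \<cdot> ?J2) = (A \<ltimes>\<^sub>2 lam\<^sub>2) \<lhd> ?J1"
      using inter_natural_right[of lam\<^sub>2 "p \<cdot> ?J2" "Id1 B A" A A j\<^sub>1 "Unit B" A]
      by (simp add: hom1_iff hom2_iff inter_id_right)
    from arg_cong[OF this, of "\<lambda>\<theta>. p \<rhd> \<theta>"] show ?thesis by simp
  qed
  have triangle: "(p \<rhd> ((A \<ltimes>\<^sub>2 lam\<^sub>2) \<lhd> ?J1)) \<bullet> (\<alpha> \<lhd> ((A \<ltimes> ?J2) \<cdot> ?J1))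
      \<bullet> (p \<rhd> ((\<rho>\<^sub>2 \<rtimes>\<^sub>2 A) \<lhd> ?J1)) = Id2 B (p \<cdot> ?J1)"
  proof -
    have "((p \<rhd> (A \<ltimes>\<^sub>2 lam\<^sub>2)) \<bullet> (\<alpha> \<lhd> (A \<ltimes> ?J2)) \<bullet> (p \<rhd> (\<rho>\<^sub>2 \<rtimes>\<^sub>2 A))) \<lhd> ?J1 = Id2 B p \<lhd> ?J1"
      using u2 by (simp only: is_unit_def)
    then show ?thesis by simp
  qed
  have "lam\<^sub>2 \<bullet> (p \<rhd> (unit_comparison j\<^sub>1 lam\<^sub>1 j\<^sub>2 \<rho>\<^sub>2 \<rtimes>\<^sub>2 A))
      = lam\<^sub>2 \<bullet> (p \<rhd> ((lam\<^sub>1 \<rtimes>\<^sub>2 A) \<lhd> ?J2)) \<bullet> ((p \<cdot> (p \<rtimes> A)) \<rhd> ?c)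
          \<bullet> (p \<rhd> ((\<rho>\<^sub>2 \<rtimes>\<^sub>2 A) \<lhd> ?J1))"
    by (simp add: unit_comparison_def)
  also have "\<dots> = (lam\<^sub>2 \<bullet> (lam\<^sub>1 \<lhd> (p \<cdot> ?J2))) \<bullet> (p \<rhd> (Inter B j\<^sub>1 p \<lhd> ?J2))
      \<bullet> ((\<alpha> \<lhd> ((j\<^sub>1 \<rtimes> (A \<otimes> A)) \<cdot> ?J2)) \<bullet> ((p \<cdot> (p \<rtimes> A)) \<rhd> ?c)) \<bullet> (p \<rhd> ((\<rho>\<^sub>2 \<rtimes>\<^sub>2 A) \<lhd> ?J1))"
    unfolding lam1_assoc by simp
  also have "\<dots> = (lam\<^sub>1 \<bullet> ((p \<cdot> ?J1) \<rhd> lam\<^sub>2))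
      \<bullet> ((p \<rhd> (Inter B j\<^sub>1 p \<lhd> ?J2)) \<bullet> ((p \<cdot> (A \<ltimes> p)) \<rhd> ?c))
      \<bullet> (\<alpha> \<lhd> ((A \<ltimes> ?J2) \<cdot> ?J1)) \<bullet> (p \<rhd> ((\<rho>\<^sub>2 \<rtimes>\<^sub>2 A) \<lhd> ?J1))"
    unfolding lam_slide alpha_slide by simp
  also have "\<dots> = lam\<^sub>1 \<bullet> (((p \<cdot> ?J1) \<rhd> lam\<^sub>2) \<bullet> (p \<rhd> Inter B j\<^sub>1 (p \<cdot> ?J2)))
      \<bullet> (\<alpha> \<lhd> ((A \<ltimes> ?J2) \<cdot> ?J1)) \<bullet> (p \<rhd> ((\<rho>\<^sub>2 \<rtimes>\<^sub>2 A) \<lhd> ?J1))"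
    unfolding inter_merge by simp
  also have "\<dots> = lam\<^sub>1"
    unfolding inter_lam triangle by simp
  finally show ?thesis .
qed

text \<open>
  The mirror image under reversal of both the tensor product and the 2-cells: compatibility of
  \<open>\<rho>\<^sub>2\<close> with \<open>\<alpha>\<close> is used instead of that of \<open>\<lambda>\<^sub>1\<close>, and the triangle for the first unit performs the
  cancellation.
\<close>

lemma unit_comparison_rho:
  assumes u1: "is_unit B A p \<alpha> j\<^sub>1 lam\<^sub>1 \<rho>\<^sub>1" and u2: "is_unit B A p \<alpha> j\<^sub>2 lam\<^sub>2 \<rho>\<^sub>2"
  shows "(p \<rhd> (A \<ltimes>\<^sub>2 unit_comparison j\<^sub>1 lam\<^sub>1 j\<^sub>2 \<rho>\<^sub>2)) \<bullet> \<rho>\<^sub>1 = \<rho>\<^sub>2"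
proof -
  note [simp] = unit_boundary[OF u1] unit_boundary[OF u2]
  let ?J1 = "A \<ltimes> j\<^sub>1" and ?J2 = "A \<ltimes> j\<^sub>2" and ?c = "Inter B (A \<ltimes> j\<^sub>1) j\<^sub>2"
  have rho2_assoc: "p \<rhd> ((A \<ltimes>\<^sub>2 \<rho>\<^sub>2) \<lhd> ?J1)
      = (\<alpha> \<lhd> (((A \<otimes> A) \<ltimes> j\<^sub>2) \<cdot> ?J1)) \<bullet> (p \<rhd> (Inter B p j\<^sub>2 \<lhd> ?J1)) \<bullet> (\<rho>\<^sub>2 \<lhd> (p \<cdot> ?J1))"
  proof -
    have "(p \<rhd> (A \<ltimes>\<^sub>2 \<rho>\<^sub>2)) \<lhd> ?J1
        = ((\<alpha> \<lhd> ((A \<otimes> A) \<ltimes> j\<^sub>2)) \<bullet> (p \<rhd> Inter B p j\<^sub>2) \<bullet> (\<rho>\<^sub>2 \<lhd> p)) \<lhd> ?J1"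
      using u2 by (simp only: is_unit_def)
    then show ?thesis by simp
  qed
  have alpha_slide: "((p \<cdot> (A \<ltimes> p)) \<rhd> ?c) \<bullet> (\<alpha> \<lhd> (((A \<otimes> A) \<ltimes> j\<^sub>2) \<cdot> ?J1))
      = (\<alpha> \<lhd> ((?J1 \<rtimes> A) \<cdot> ?J2)) \<bullet> ((p \<cdot> (p \<rtimes> A)) \<rhd> ?c)"
    by (rule whisker_exchange[symmetric]) (simp_all add: hom2_iff)
  have inter_merge: "((p \<cdot> (p \<rtimes> A)) \<rhd> ?c) \<bullet> (p \<rhd> (Inter B p j\<^sub>2 \<lhd> ?J1))
      = p \<rhd> Inter B (p \<cdot> ?J1) j\<^sub>2"
    using inter_comp_left[of ?J1 A "A \<otimes> A" p A j\<^sub>2 "Unit B" A] by (simp add: hom1_iff)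
  have rho_slide: "(\<rho>\<^sub>2 \<lhd> (p \<cdot> ?J1)) \<bullet> \<rho>\<^sub>1 = ((p \<cdot> ?J2) \<rhd> \<rho>\<^sub>1) \<bullet> \<rho>\<^sub>2"
    using whisker_exchange[of \<rho>\<^sub>1 "Id1 B A" "p \<cdot> ?J1" \<rho>\<^sub>2 "Id1 B A" "p \<cdot> ?J2"]
    by (simp add: hom2_iff)
  have inter_rho: "(p \<rhd> Inter B (p \<cdot> ?J1) j\<^sub>2) \<bullet> ((p \<cdot> ?J2) \<rhd> \<rho>\<^sub>1)
      = p \<rhd> ((\<rho>\<^sub>1 \<rtimes>\<^sub>2 A) \<lhd> ?J2)"
  proof -
    have "Inter B (p \<cdot> ?J1) j\<^sub>2 \<bullet> (?J2 \<rhd> \<rho>\<^sub>1) = (\<rho>\<^sub>1 \<rtimes>\<^sub>2 A) \<lhd> ?J2"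
      using inter_natural_left[of \<rho>\<^sub>1 "Id1 B A" "p \<cdot> ?J1" A A j\<^sub>2 "Unit B" A]
      by (simp add: hom1_iff hom2_iff inter_id_left)
    from arg_cong[OF this, of "\<lambda>\<theta>. p \<rhd> \<theta>"] show ?thesis by simp
  qed
  have triangle: "(p \<rhd> ((A \<ltimes>\<^sub>2 lam\<^sub>1) \<lhd> ?J2)) \<bullet> (\<alpha> \<lhd> ((?J1 \<rtimes> A) \<cdot> ?J2))
      \<bullet> (p \<rhd> ((\<rho>\<^sub>1 \<rtimes>\<^sub>2 A) \<lhd> ?J2)) = Id2 B (p \<cdot> ?J2)"
  proof -
    have "((p \<rhd> (A \<ltimes>\<^sub>2 lam\<^sub>1)) \<bullet> (\<alpha> \<lhd> (A \<ltimes> (j\<^sub>1 \<rtimes> A))) \<bullet> (p \<rhd> (\<rho>\<^sub>1 \<rtimes>\<^sub>2 A))) \<lhd> ?J2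
        = Id2 B p \<lhd> ?J2"
      using u1 by (simp only: is_unit_def)
    then show ?thesis by simp
  qed
  have "(p \<rhd> (A \<ltimes>\<^sub>2 unit_comparison j\<^sub>1 lam\<^sub>1 j\<^sub>2 \<rho>\<^sub>2)) \<bullet> \<rho>\<^sub>1
      = (p \<rhd> ((A \<ltimes>\<^sub>2 lam\<^sub>1) \<lhd> ?J2)) \<bullet> ((p \<cdot> (A \<ltimes> p)) \<rhd> ?c)
          \<bullet> (p \<rhd> ((A \<ltimes>\<^sub>2 \<rho>\<^sub>2) \<lhd> ?J1)) \<bullet> \<rho>\<^sub>1"
    by (simp add: unit_comparison_def)
  also have "\<dots> = (p \<rhd> ((A \<ltimes>\<^sub>2 lam\<^sub>1) \<lhd> ?J2))
      \<bullet> (((p \<cdot> (A \<ltimes> p)) \<rhd> ?c) \<bullet> (\<alpha> \<lhd> (((A \<otimes> A) \<ltimes> j\<^sub>2) \<cdot> ?J1)))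
      \<bullet> (p \<rhd> (Inter B p j\<^sub>2 \<lhd> ?J1)) \<bullet> ((\<rho>\<^sub>2 \<lhd> (p \<cdot> ?J1)) \<bullet> \<rho>\<^sub>1)"
    unfolding rho2_assoc by simp
  also have "\<dots> = (p \<rhd> ((A \<ltimes>\<^sub>2 lam\<^sub>1) \<lhd> ?J2)) \<bullet> (\<alpha> \<lhd> ((?J1 \<rtimes> A) \<cdot> ?J2))
      \<bullet> (((p \<cdot> (p \<rtimes> A)) \<rhd> ?c) \<bullet> (p \<rhd> (Inter B p j\<^sub>2 \<lhd> ?J1))) \<bullet> (((p \<cdot> ?J2) \<rhd> \<rho>\<^sub>1) \<bullet> \<rho>\<^sub>2)"
    unfolding alpha_slide rho_slide by simp
  also have "\<dots> = (p \<rhd> ((A \<ltimes>\<^sub>2 lam\<^sub>1) \<lhd> ?J2)) \<bullet> (\<alpha> \<lhd> ((?J1 \<rtimes> A) \<cdot> ?J2))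
      \<bullet> ((p \<rhd> Inter B (p \<cdot> ?J1) j\<^sub>2) \<bullet> ((p \<cdot> ?J2) \<rhd> \<rho>\<^sub>1)) \<bullet> \<rho>\<^sub>2"
    unfolding inter_merge by simp
  also have "\<dots> = ((p \<rhd> ((A \<ltimes>\<^sub>2 lam\<^sub>1) \<lhd> ?J2)) \<bullet> (\<alpha> \<lhd> ((?J1 \<rtimes> A) \<cdot> ?J2))
      \<bullet> (p \<rhd> ((\<rho>\<^sub>1 \<rtimes>\<^sub>2 A) \<lhd> ?J2))) \<bullet> \<rho>\<^sub>2"
    unfolding inter_rho by simp
  also have "\<dots> = \<rho>\<^sub>2"
    unfolding triangle by simp
  finally show ?thesis .
qed

text \<open>
  Expressing \<open>\<rho>\<^sub>2\<close> through \<open>\<rho>\<^sub>1\<close> and \<open>\<phi>\<close>, and then sliding \<open>\<phi>\<close> through the interchange 2-cell and past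
  \<open>\<lambda>\<^sub>1\<close>, leaves the composite of \<open>\<rho>\<^sub>1\<close> and \<open>\<lambda>\<^sub>1\<close> on \<open>j\<^sub>1\<close>, which the last unit axiom makes an identity.
\<close>

lemma unit_hom_eq_comparison:
  assumes u1: "is_unit B A p \<alpha> j\<^sub>1 lam\<^sub>1 \<rho>\<^sub>1" and u2: "is_unit B A p \<alpha> j\<^sub>2 lam\<^sub>2 \<rho>\<^sub>2"
    and \<phi>: "\<phi> \<in> unit_hom B A p (j\<^sub>1, lam\<^sub>1, \<rho>\<^sub>1) (j\<^sub>2, lam\<^sub>2, \<rho>\<^sub>2)"
  shows "\<phi> = unit_comparison j\<^sub>1 lam\<^sub>1 j\<^sub>2 \<rho>\<^sub>2"
proof -
  note [simp] = unit_boundary[OF u1] unit_boundary[OF u2]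
  have [simp]: "\<phi> \<in> Cell2 B" "Dom B \<phi> = j\<^sub>1" "Cod B \<phi> = j\<^sub>2"
    and rho2: "\<rho>\<^sub>2 = (p \<rhd> (A \<ltimes>\<^sub>2 \<phi>)) \<bullet> \<rho>\<^sub>1"
    using \<phi> by (auto simp: hom2_iff)
  have inter_phi: "(p \<rhd> Inter B j\<^sub>1 j\<^sub>2) \<bullet> (p \<rhd> ((A \<ltimes>\<^sub>2 \<phi>) \<lhd> j\<^sub>1))
      = ((p \<cdot> (j\<^sub>1 \<rtimes> A)) \<rhd> \<phi>) \<bullet> (p \<rhd> Inter B j\<^sub>1 j\<^sub>1)"
  proof -
    have "Inter B j\<^sub>1 j\<^sub>2 \<bullet> ((A \<ltimes>\<^sub>2 \<phi>) \<lhd> j\<^sub>1) = ((j\<^sub>1 \<rtimes> A) \<rhd> \<phi>) \<bullet> Inter B j\<^sub>1 j\<^sub>1"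
      using inter_natural_right[of \<phi> j\<^sub>1 j\<^sub>2 "Unit B" A j\<^sub>1 "Unit B" A]
      by (simp add: hom1_iff hom2_iff)
    from arg_cong[OF this, of "\<lambda>\<theta>. p \<rhd> \<theta>"] show ?thesis by simp
  qed
  have lam_slide: "(lam\<^sub>1 \<lhd> j\<^sub>2) \<bullet> ((p \<cdot> (j\<^sub>1 \<rtimes> A)) \<rhd> \<phi>) = \<phi> \<bullet> (lam\<^sub>1 \<lhd> j\<^sub>1)"
    using whisker_exchange[of \<phi> j\<^sub>1 j\<^sub>2 lam\<^sub>1 "p \<cdot> (j\<^sub>1 \<rtimes> A)" "Id1 B A"] by (simp add: hom2_iff)
  have "unit_comparison j\<^sub>1 lam\<^sub>1 j\<^sub>2 \<rho>\<^sub>2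
      = (lam\<^sub>1 \<lhd> j\<^sub>2) \<bullet> ((p \<rhd> Inter B j\<^sub>1 j\<^sub>2) \<bullet> (p \<rhd> ((A \<ltimes>\<^sub>2 \<phi>) \<lhd> j\<^sub>1))) \<bullet> (\<rho>\<^sub>1 \<lhd> j\<^sub>1)"
    unfolding unit_comparison_def rho2 by simp
  also have "\<dots> = ((lam\<^sub>1 \<lhd> j\<^sub>2) \<bullet> ((p \<cdot> (j\<^sub>1 \<rtimes> A)) \<rhd> \<phi>)) \<bullet> (p \<rhd> Inter B j\<^sub>1 j\<^sub>1) \<bullet> (\<rho>\<^sub>1 \<lhd> j\<^sub>1)"
    unfolding inter_phi by simp
  also have "\<dots> = \<phi> \<bullet> ((lam\<^sub>1 \<lhd> j\<^sub>1) \<bullet> (p \<rhd> Inter B j\<^sub>1 j\<^sub>1) \<bullet> (\<rho>\<^sub>1 \<lhd> j\<^sub>1))"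
    unfolding lam_slide by simp
  also have "\<dots> = \<phi>"
    using u1 by (simp add: is_unit_def)
  finally show ?thesis by simp
qed

lemma unit_hom_singleton:
  assumes "is_unit B A p \<alpha> j\<^sub>1 lam\<^sub>1 \<rho>\<^sub>1" "is_unit B A p \<alpha> j\<^sub>2 lam\<^sub>2 \<rho>\<^sub>2"
  shows "unit_hom B A p (j\<^sub>1, lam\<^sub>1, \<rho>\<^sub>1) (j\<^sub>2, lam\<^sub>2, \<rho>\<^sub>2) = {unit_comparison j\<^sub>1 lam\<^sub>1 j\<^sub>2 \<rho>\<^sub>2}"
proof
  show "unit_hom B A p (j\<^sub>1, lam\<^sub>1, \<rho>\<^sub>1) (j\<^sub>2, lam\<^sub>2, \<rho>\<^sub>2) \<subseteq> {unit_comparison j\<^sub>1 lam\<^sub>1 j\<^sub>2 \<rho>\<^sub>2}"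
    using unit_hom_eq_comparison[OF assms] by blast
qed (simp add: unit_comparison_in[OF assms] unit_comparison_lam[OF assms]
      unit_comparison_rho[OF assms])

end

section \<open>Uniqueness of units\<close>

lemma (in category) ex1_isomorphism_if_indiscrete:
  assumes x: "x \<in> CObj C" and y: "y \<in> CObj C"
    and indiscrete: "\<And>u v. \<lbrakk>u \<in> CObj C; v \<in> CObj C\<rbrakk> \<Longrightarrow> \<exists>m. CHom C u v = {m}"
  shows "\<exists>!f. isomorphism C x y f"
proof -
  have eq: "f = g" if "f \<in> CHom C u v" "g \<in> CHom C u v" "u \<in> CObj C" "v \<in> CObj C" for f g u v
    using indiscrete[OF that(3,4)] that(1,2) by auto
  obtain f g where fg: "f \<in> CHom C x y" "g \<in> CHom C y x"
    using indiscrete[OF x y] indiscrete[OF y x] by auto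
  have "CComp C g f = CId C x"
    by (rule eq[OF comp_in[OF x y x fg] id_in[OF x] x x])
  moreover have "CComp C f g = CId C y"
    by (rule eq[OF comp_in[OF y x y fg(2,1)] id_in[OF y] y y])
  ultimately have "isomorphism C x y f"
    using x y fg by (auto simp: isomorphism_def)
  then show ?thesis
    using eq by (auto simp: isomorphism_def)
qed

theorem proposition3p3:
  fixes B :: "('o, 'a, 'c, 'z) gray_scheme"
    and A :: 'o and p j j\<^sub>1 j\<^sub>2 :: 'a and \<alpha> lam \<rho> lam\<^sub>1 \<rho>\<^sub>1 lam\<^sub>2 \<rho>\<^sub>2 :: 'c
  assumes "gray_monoid B"
    and "skew_monoidale B A p j \<alpha> lam \<rho>"
    and "(j\<^sub>1, lam\<^sub>1, \<rho>\<^sub>1) \<in> CObj (units_cat B A p \<alpha>)"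
    and "(j\<^sub>2, lam\<^sub>2, \<rho>\<^sub>2) \<in> CObj (units_cat B A p \<alpha>)"
  shows "\<exists>!\<phi>. isomorphism (units_cat B A p \<alpha>) (j\<^sub>1, lam\<^sub>1, \<rho>\<^sub>1) (j\<^sub>2, lam\<^sub>2, \<rho>\<^sub>2) \<phi>"
proof -
  interpret skew_monoidale B A p j \<alpha> lam \<rho> by (rule assms(2))
  show ?thesis
  proof (rule category.ex1_isomorphism_if_indiscrete[OF category_units_cat assms(3,4)])
    fix u v assume "u \<in> CObj (units_cat B A p \<alpha>)" "v \<in> CObj (units_cat B A p \<alpha>)"
    then show "\<exists>m. CHom (units_cat B A p \<alpha>) u v = {m}"
      by (cases u; cases v) (auto simp: units_cat_def unit_hom_singleton simp del: unit_hom.simps)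
  qed
qed

end
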